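(* Let $R$ be a transit function on a finite set $V$. Then $R$ satisfies Axioms (b1'), (b2'), (J2), (J4), (J4'), (TW1') and (TWA) if and only if the underlying graph $G_R$ is an AT-free graph and $R=T$ on $G_R$, i.e. $R(u,v)=T(u,v)$ for all $u,v\in V$, where $T$ is the toll walk transit function of $G_R$.
   Context: A transit function on a set $V$ is a map $R:V\times V\to 2^V$ such that for all $u,v\in V$: $u\in R(u,v)$, $R(u,v)=R(v,u)$ and $R(u,u)=\{u\}$. The underlying graph $G_R$ has vertex set $V$, and distinct $u,v$ are adjacent iff $R(u,v)=\{u,v\}$. In a finite simple graph $G$, a walk $W=w_1w_2\cdots w_k$ ($k\ge 2$) is a toll walk if $w_1\neq w_k$, $w_2$ is the only neighbor of $w_1$ among the vertices of $W$, and $w_{k-1}$ is the only neighbor of $w_k$ among the vertices of $W$. The toll walk transit function $T$ of $G$ is given by $T(u,u)=\{u\}$ and, for $u\ne v$, $T(u,v)$ is the set of all vertices lying on some toll walk from $u$ to $v$. Three vertices form an asteroidal triple if each two of them are joined by a path containing no neighbor of the third; a graph is AT-free if it has no asteroidal triple. The axioms (all quantified over elements of $V$): (b1') If $x\in R(u,v)$, $v\neq x$ and $R(v,x)\neq\{v,x\}$, then $v\notin R(u,x)$. (b2') If $x\in R(u,v)$ and $R(u,x)\neq\{u,x\}$, then $R(x,v)\subseteq R(u,v)$. (J2) If $R(u,x)=\{u,x\}$, $R(x,v)=\{x,v\}$, $u\neq v$ and $R(u,v)\neq\{u,v\}$, then $x\in R(u,v)$. (J4) If $x\in R(u,y)$,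 $y\in R(x,v)$, $x\neq y$, $R(u,x)=\{u,x\}$, $R(y,v)=\{y,v\}$ and $R(u,v)\neq\{u,v\}$, then $x\in R(u,v)$. (J4') If $x\in R(u,y)$, $y\in R(x,v)$, $R(u,x)\neq\{u,x\}$, $R(y,v)\neq\{y,v\}$, $R(x,y)\neq\{x,y\}$ and $R(u,v)\neq\{u,v\}$, then $x\in R(u,v)$. (TW1') If $x,y\in R(u,v)$, $x\neq u$, $y\neq v$, $R(x,v)\neq\{x,v\}$, $R(u,y)\neq\{u,y\}$, $R(x,z)=\{x,z\}$, $R(z,w)=\{z,w\}$, $R(w,y)=\{w,y\}$ and $R(u,w)\neq\{u,w\}$, then $z\in R(u,v)$. (TWA) If $u,v,x$ are pairwise distinct and $x\in R(u,v)$, then there exists $x_1\in R(x,v)\cap R(u,v)$ with $x_1\neq x$, $R(x,x_1)=\{x,x_1\}$, $R(u,x_1)\neq\{u,x_1\}$ and $R(x_1,v)\subsetneq R(x,v)$. *)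

theory Defs
  imports Graph_Theory.Graph_Theory
begin

definition transit_function :: "'a set \<Rightarrow> ('a \<Rightarrow> 'a \<Rightarrow> 'a set) \<Rightarrow> bool" where
  "transit_function V R \<longleftrightarrow>
     (\<forall>u\<in>V. \<forall>v\<in>V. R u v \<subseteq> V \<and> u \<in> R u v \<and> R u v = R v u) \<and> (\<forall>u\<in>V. R u u = {u})"

text \<open>
  A finite simple graph is a finite, symmetric and loop-free digraph without parallel arcs, so that
  each undirected edge is represented by its two orientations.
\<close>

definition underlying_graph :: "'a set \<Rightarrow> ('a \<Rightarrow> 'a \<Rightarrow> 'a set) \<Rightarrow> 'a pair_pre_digraph" where
  "underlying_graph V R =
     \<lparr>pverts = V, parcs = {(u, v). u \<in> V \<and> v \<in> V \<and> u \<noteq> v \<and> R u v = {u, v}}\<rparr>"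

lemma pair_graph_underlying_graph:
  assumes "finite V" and "transit_function V R"
  shows "pair_graph (underlying_graph V R)"
proof -
  let ?A = "{(u, v). u \<in> V \<and> v \<in> V \<and> u \<noteq> v \<and> R u v = {u, v}}"
  have "?A \<subseteq> V \<times> V" by auto
  then have fin: "finite ?A" using assms(1) by (meson finite_SigmaI finite_subset)
  have "R u v = R v u" if "u \<in> V" "v \<in> V" for u v
    using assms(2) that by (auto simp: transit_function_def)
  then have "sym ?A" by (auto simp: sym_def insert_commute)
  with assms(1) fin show ?thesis
    by unfold_locales (auto simp: underlying_graph_def symmetric_def)
qed

text \<open>
  ``The only neighbour of the first vertex is the second one'' refers to positions in the walk, so
  the second vertex must not be repeated later on (dually for the last but one). Comparing vertices
  instead of positions would be weaker: in a star with centre $c$ and leaves $u$, $v$, $x$ it would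
  admit the walk $u, c, x, c, v$, and the toll interval between $u$ and $v$ would contain $x$.
\<close>

definition toll_walk :: "('a, 'b) pre_digraph \<Rightarrow> 'a list \<Rightarrow> bool" where
  "toll_walk G p \<longleftrightarrow>
     vwalk p G \<and> 2 \<le> length p \<and> hd p \<noteq> last p \<and>
     (\<forall>i<length p. hd p \<rightarrow>\<^bsub>G\<^esub> p ! i \<longleftrightarrow> i = 1) \<and>
     (\<forall>i<length p. last p \<rightarrow>\<^bsub>G\<^esub> p ! i \<longleftrightarrow> i = length p - 2)"

definition toll_transit :: "('a, 'b) pre_digraph \<Rightarrow> 'a \<Rightarrow> 'a \<Rightarrow> 'a set" where
  "toll_transit G u v =
     (if u = v then {u} else {x. \<exists>p. toll_walk G p \<and> hd p = u \<and> last p = v \<and> x \<in> set p})"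

definition path_avoiding_nbrs :: "('a, 'b) pre_digraph \<Rightarrow> 'a \<Rightarrow> 'a \<Rightarrow> 'a \<Rightarrow> bool" where
  "path_avoiding_nbrs G a b c \<longleftrightarrow>
     (\<exists>p. vpath p G \<and> hd p = a \<and> last p = b \<and> (\<forall>x\<in>set p. \<not> c \<rightarrow>\<^bsub>G\<^esub> x))"

definition asteroidal_triple :: "('a, 'b) pre_digraph \<Rightarrow> 'a \<Rightarrow> 'a \<Rightarrow> 'a \<Rightarrow> bool" where
  "asteroidal_triple G a b c \<longleftrightarrow>
     a \<in> verts G \<and> b \<in> verts G \<and> c \<in> verts G \<and> a \<noteq> b \<and> b \<noteq> c \<and> a \<noteq> c \<and>
     path_avoiding_nbrs G a b c \<and> path_avoiding_nbrs G b c a \<and> path_avoiding_nbrs G a c b"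

definition AT_free :: "('a, 'b) pre_digraph \<Rightarrow> bool" where
  "AT_free G \<longleftrightarrow> (\<nexists>a b c. asteroidal_triple G a b c)"

definition ax_b1' :: "'a set \<Rightarrow> ('a \<Rightarrow> 'a \<Rightarrow> 'a set) \<Rightarrow> bool" where
  "ax_b1' V R \<longleftrightarrow> (\<forall>u\<in>V. \<forall>v\<in>V. \<forall>x\<in>V.
     x \<in> R u v \<and> v \<noteq> x \<and> R v x \<noteq> {v, x} \<longrightarrow> v \<notin> R u x)"

definition ax_b2' :: "'a set \<Rightarrow> ('a \<Rightarrow> 'a \<Rightarrow> 'a set) \<Rightarrow> bool" where
  "ax_b2' V R \<longleftrightarrow> (\<forall>u\<in>V. \<forall>v\<in>V. \<forall>x\<in>V.
     x \<in> R u v \<and> R u x \<noteq> {u, x} \<longrightarrow> R x v \<subseteq> R u v)"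

definition ax_J2 :: "'a set \<Rightarrow> ('a \<Rightarrow> 'a \<Rightarrow> 'a set) \<Rightarrow> bool" where
  "ax_J2 V R \<longleftrightarrow> (\<forall>u\<in>V. \<forall>v\<in>V. \<forall>x\<in>V.
     R u x = {u, x} \<and> R x v = {x, v} \<and> u \<noteq> v \<and> R u v \<noteq> {u, v} \<longrightarrow> x \<in> R u v)"

definition ax_J4 :: "'a set \<Rightarrow> ('a \<Rightarrow> 'a \<Rightarrow> 'a set) \<Rightarrow> bool" where
  "ax_J4 V R \<longleftrightarrow> (\<forall>u\<in>V. \<forall>v\<in>V. \<forall>x\<in>V. \<forall>y\<in>V.
     x \<in> R u y \<and> y \<in> R x v \<and> x \<noteq> y \<and> R u x = {u, x} \<and> R y v = {y, v} \<and> R u v \<noteq> {u, v}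
     \<longrightarrow> x \<in> R u v)"

definition ax_J4' :: "'a set \<Rightarrow> ('a \<Rightarrow> 'a \<Rightarrow> 'a set) \<Rightarrow> bool" where
  "ax_J4' V R \<longleftrightarrow> (\<forall>u\<in>V. \<forall>v\<in>V. \<forall>x\<in>V. \<forall>y\<in>V.
     x \<in> R u y \<and> y \<in> R x v \<and> R u x \<noteq> {u, x} \<and> R y v \<noteq> {y, v} \<and> R x y \<noteq> {x, y} \<and> R u v \<noteq> {u, v}
     \<longrightarrow> x \<in> R u v)"

definition ax_TW1' :: "'a set \<Rightarrow> ('a \<Rightarrow> 'a \<Rightarrow> 'a set) \<Rightarrow> bool" where
  "ax_TW1' V R \<longleftrightarrow> (\<forall>u\<in>V. \<forall>v\<in>V. \<forall>x\<in>V. \<forall>y\<in>V. \<forall>z\<in>V. \<forall>w\<in>V.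
     x \<in> R u v \<and> y \<in> R u v \<and> x \<noteq> u \<and> y \<noteq> v \<and> R x v \<noteq> {x, v} \<and> R u y \<noteq> {u, y} \<and>
     R x z = {x, z} \<and> R z w = {z, w} \<and> R w y = {w, y} \<and> R u w \<noteq> {u, w}
     \<longrightarrow> z \<in> R u v)"

definition ax_TWA :: "'a set \<Rightarrow> ('a \<Rightarrow> 'a \<Rightarrow> 'a set) \<Rightarrow> bool" where
  "ax_TWA V R \<longleftrightarrow> (\<forall>u\<in>V. \<forall>v\<in>V. \<forall>x\<in>V.
     u \<noteq> v \<and> u \<noteq> x \<and> v \<noteq> x \<and> x \<in> R u v
     \<longrightarrow> (\<exists>x1 \<in> R x v \<inter> R u v. x1 \<noteq> x \<and> R x x1 = {x, x1} \<and> R u x1 \<noteq> {u, x1} \<and> R x1 v \<subset> R x v))"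

end

theory Submission
  imports Defs
begin

text \<open>
  For non-adjacent \<open>u\<close> and \<open>v\<close>, an inner vertex \<open>x\<close> lies on a toll walk from \<open>u\<close> to \<open>v\<close> iff there
  are a walk from \<open>x\<close> to \<open>v\<close> avoiding (after \<open>x\<close>) the closed neighbourhood of \<open>u\<close> and a walk from
  \<open>x\<close> to \<open>u\<close> avoiding that of \<open>v\<close>. With this description the axioms for \<open>T\<close> on an AT-free graph
  become statements about components outside closed neighbourhoods.

  Conversely, iterating (TWA) gives \<open>R u v \<subseteq> T u v\<close>, and (J2), (J4), (J4'), (TW1') put every induced
  path from \<open>u\<close> to \<open>v\<close> into \<open>R u v\<close>. If \<open>x \<in> T u v - R u v\<close>, let \<open>K\<close> be the component of \<open>x\<close> outside
  the closed neighbourhoods of \<open>u\<close> and \<open>v\<close>; by (TW1') it is disjoint from \<open>R u v\<close>. Take a path \<open>s, k\<^sub>1, \<dots>, k\<^sub>r, t\<close>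
  through \<open>K\<close>, chordless up to the pair \<open>s, t\<close>, where \<open>s\<close> is a neighbour of \<open>u\<close> only and \<open>t\<close> one of \<open>v\<close>
  only. Then \<open>r \<ge> 3\<close> by (TW1'). If \<open>s\<close> and \<open>t\<close> are not adjacent, \<open>u, s, k\<^sub>1, \<dots>, k\<^sub>r, t, v\<close> is an
  induced path. Otherwise \<open>v \<in> R u k\<close> and \<open>u \<in> R v k\<close> for \<open>k = k\<^bsub>r-1\<^esub>\<close>, contradicting (b1').
  Finally, an asteroidal triple in \<open>T = R\<close> contradicts (b1').
\<close>


section \<open>Walks outside a set and induced paths\<close>

context pair_graph
begin

abbreviation adj :: "'a \<Rightarrow> 'a \<Rightarrow> bool" where
  "adj a b \<equiv> (a, b) \<in> parcs G"

text \<open>Closed neighbourhoods match the axioms, since \<open>R a b = {a, b}\<close> holds for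
  \<open>a = b\<close> as well.\<close>

definition nb :: "'a \<Rightarrow> 'a set" where
  "nb c = insert c {a. adj c a}"

text \<open>The starting vertex of the walk is allowed to lie in \<open>S\<close>.\<close>

definition reach :: "'a set \<Rightarrow> 'a \<Rightarrow> 'a \<Rightarrow> bool" where
  "reach S = (\<lambda>a b. adj a b \<and> b \<notin> S)\<^sup>*\<^sup>*"

text \<open>With \<open>a\<close> outside \<open>nb c\<close> the relation is symmetric:
  \<open>a\<close> and \<open>b\<close> lie in one component of the graph minus the closed
  neighbourhood of \<open>c\<close>.\<close>

definition conn :: "'a \<Rightarrow> 'a \<Rightarrow> 'a \<Rightarrow> bool" where
  "conn c a b \<longleftrightarrow> a \<notin> nb c \<and> reach (nb c) a b"

text \<open>These are the inner vertices of toll walks between non-adjacent \<open>u\<close> and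
  \<open>v\<close>. As \<open>reach\<close> exempts its start, \<open>x\<close> itself may be a
  neighbour of \<open>u\<close> or \<open>v\<close>.\<close>

definition toll :: "'a \<Rightarrow> 'a \<Rightarrow> 'a \<Rightarrow> bool" where
  "toll u v x \<longleftrightarrow> x \<noteq> u \<and> x \<noteq> v \<and> v \<notin> nb u \<and> reach (nb u) x v \<and> reach (nb v) x u"

text \<open>Indexing by numbers up to the edge count \<open>k\<close> turns cutting, reversing and
  prepending (by \<open>case_nat\<close>) into index shifts.\<close>

definition induced_path :: "(nat \<Rightarrow> 'a) \<Rightarrow> nat \<Rightarrow> bool" where
  "induced_path p k \<longleftrightarrow> (\<forall>i\<le>k. p i \<in> pverts G) \<and>
     (\<forall>i j. i < j \<and> j \<le> k \<longrightarrow> p i \<noteq> p j \<and> (adj (p i) (p j) \<longleftrightarrow> j = Suc i))"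

lemma adj_sym: "adj a b \<Longrightarrow> adj b a"
  by (rule arcs_symmetric)

lemma adj_commute: "adj a b \<longleftrightarrow> adj b a"
  by (blast intro: adj_sym)

lemma adj_irrefl [simp]: "\<not> adj a a"
  using no_loops' by blast

lemma adj_verts: "adj a b \<Longrightarrow> a \<in> pverts G \<and> b \<in> pverts G"
  by (auto dest: in_arcsD1 in_arcsD2)

lemma nb_self [simp]: "c \<in> nb c"
  by (simp add: nb_def)

lemma nb_commute: "a \<in> nb c \<longleftrightarrow> c \<in> nb a"
  by (auto simp: nb_def dest: adj_sym)

lemma reach_refl [simp]: "reach S a a"
  by (simp add: reach_def)

lemma reach_trans: "reach S a b \<Longrightarrow> reach S b c \<Longrightarrow> reach S a c"
  unfolding reach_def by (rule rtranclp_trans)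

lemma reach_step: "adj a b \<Longrightarrow> b \<notin> S \<Longrightarrow> reach S a b"
  unfolding reach_def by (rule r_into_rtranclp) simp

lemma reach_mono: "reach T a b \<Longrightarrow> S \<subseteq> T \<Longrightarrow> reach S a b"
  unfolding reach_def by (erule rtranclp_mono[THEN predicate2D, rotated]) auto

lemma reach_end: "reach S a b \<Longrightarrow> b \<notin> S \<or> b = a"
  unfolding reach_def by (erule rtranclp.cases) auto

lemma reach_sym:
  assumes "reach S a b" "a \<notin> S"
  shows "reach S b a"
  using assms(1) unfolding reach_def
proof (induction rule: rtranclp_induct)
  case (step y z)
  have "y \<notin> S" using reach_end[unfolded reach_def, OF step(1)] assms(2) by auto
  with step have "adj z y \<and> y \<notin> S" by (blast intro: adj_sym)
  then show ?case using step.IH by (rule converse_rtranclp_into_rtranclp)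
qed simp

text \<open>Cut the walk at its last visit to \<open>D\<close> after the start, if there is
  one.\<close>

lemma reach_last_hit:
  assumes "reach S a b"
  shows "reach (S \<union> D) a b \<or> (\<exists>m\<in>D. m \<notin> S \<and> reach S a m \<and> reach (S \<union> D) m b)"
  using assms unfolding reach_def
proof (induction rule: rtranclp_induct)
  case (step y z)
  show ?case
  proof (cases "z \<in> D")
    case True
    with step show ?thesis by (metis (mono_tags, lifting) rtranclp.simps)
  next
    case False
    with step show ?thesis
      by (smt (verit, ccfv_SIG) Un_iff rtranclp.rtrancl_into_rtrancl)
  qed
qed simp

lemma conn_sym: "conn c a b \<Longrightarrow> conn c b a"
  using reach_sym reach_end unfolding conn_def by blast

lemma conn_trans: "conn c a b \<Longrightarrow> conn c b d \<Longrightarrow> conn c a d"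
  using reach_trans unfolding conn_def by blast

lemma conn_nb: "conn c a b \<Longrightarrow> a \<notin> nb c \<and> b \<notin> nb c"
  using conn_sym conn_def by blast

text \<open>The main device for producing asteroidal triples: a walk that cannot be kept away from
  \<open>nb d\<close> meets it, and \<open>d\<close> can join the walk at the last vertex
  met.\<close>

lemma reach_hit_nb:
  assumes "reach S a b" "\<not> reach (nb d) a b"
  shows "reach S d b"
proof -
  obtain m where m: "m \<in> nb d" "m \<notin> S" "reach S m b"
    using reach_last_hit[OF assms(1), of "nb d"] assms(2) reach_mono by (meson Un_upper1 Un_upper2)
  then show ?thesis by (auto simp: nb_def intro: reach_trans reach_step)
qed

lemma induced_pathD:
  assumes "induced_path p k"
  shows "i \<le> k \<Longrightarrow> p i \<in> pverts G"
    and "i \<le> k \<Longrightarrow> j \<le> k \<Longrightarrow> p i = p j \<longleftrightarrow> i = j"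
    and "i \<le> k \<Longrightarrow> j \<le> k \<Longrightarrow> adj (p i) (p j) \<longleftrightarrow> j = Suc i \<or> i = Suc j"
proof -
  show "i \<le> k \<Longrightarrow> p i \<in> pverts G"
    and "i \<le> k \<Longrightarrow> j \<le> k \<Longrightarrow> p i = p j \<longleftrightarrow> i = j"
    using assms unfolding induced_path_def by (metis linorder_neqE_nat)+
  show "i \<le> k \<Longrightarrow> j \<le> k \<Longrightarrow> adj (p i) (p j) \<longleftrightarrow> j = Suc i \<or> i = Suc j"
    using assms unfolding induced_path_def
    by (cases i j rule: linorder_cases) (auto dest: adj_sym)
qed

lemma induced_path_sub: "induced_path p k \<Longrightarrow> m + l \<le> k \<Longrightarrow> induced_path (\<lambda>i. p (i + m)) l"
  unfolding induced_path_def by auto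

lemma induced_path_rev: "induced_path p k \<Longrightarrow> induced_path (\<lambda>i. p (k - i)) k"
  unfolding induced_path_def[of "\<lambda>i. p (k - i)"] by (auto simp: induced_pathD)

lemma induced_path_Cons:
  assumes "induced_path p k" "adj a (p 0)" "\<And>i. 0 < i \<Longrightarrow> i \<le> k \<Longrightarrow> p i \<notin> nb a"
  shows "induced_path (case_nat a p) (Suc k)"
proof -
  have "a \<noteq> p i \<and> (adj a (p i) \<longleftrightarrow> i = 0)" if "i \<le> k" for i
    using assms(2) assms(3)[of i] that by (cases "i = 0") (auto simp: nb_def)
  then show ?thesis
    using assms adj_verts[OF assms(2)]
    by (auto simp: induced_path_def all_conj_distrib split: nat.splits)
qed

text \<open>The path is built from the far end of the walk. Before \<open>a\<close> is prepended,
  everything ahead of the last vertex in \<open>nb a\<close> is dropped, which leaves no chord at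
  \<open>a\<close>.\<close>

lemma reach_induced_path:
  assumes "reach S a b" "a \<in> pverts G"
  obtains p k where "induced_path p k" "p 0 = a" "p k = b" "\<And>i. 0 < i \<Longrightarrow> i \<le> k \<Longrightarrow> p i \<notin> S"
proof -
  have "\<exists>p k. induced_path p k \<and> p 0 = a \<and> p k = b \<and> (\<forall>i. 0 < i \<and> i \<le> k \<longrightarrow> p i \<notin> S)"
    using assms unfolding reach_def
  proof (induction rule: converse_rtranclp_induct)
    case base
    then show ?case by (intro exI[of _ "\<lambda>_. b"] exI[of _ 0]) (simp add: induced_path_def)
  next
    case (step a c)
    obtain p k where p: "induced_path p k" "p 0 = c" "p k = b" "\<forall>i. 0 < i \<and> i \<le> k \<longrightarrow> p i \<notin> S"
      using step adj_verts by blast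
    define m where "m = Max {i. i \<le> k \<and> p i \<in> nb a}"
    have fin: "finite {i. i \<le> k \<and> p i \<in> nb a}" by simp
    have "0 \<in> {i. i \<le> k \<and> p i \<in> nb a}" using p step by (simp add: nb_def)
    then have "m \<in> {i. i \<le> k \<and> p i \<in> nb a}" unfolding m_def using Max_in[OF fin] by blast
    then have m: "m \<le> k" "p m \<in> nb a" by auto
    have mx: "p i \<notin> nb a" if "m < i" "i \<le> k" for i
      using Max_ge[OF fin, of i] that unfolding m_def[symmetric] by auto
    have sub: "induced_path (\<lambda>i. p (i + m)) (k - m)" using induced_path_sub[OF p(1)] m by simp
    have S: "p i \<notin> S" if "i \<le> k" for i using p step that by (cases "i = 0") auto
    show ?case
    proof (cases "p m = a")
      case True
      then show ?thesis using sub p m S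
        by (intro exI[of _ "\<lambda>i. p (i + m)"] exI[of _ "k - m"]) auto
    next
      case False
      then have "induced_path (case_nat a (\<lambda>i. p (i + m))) (Suc (k - m))"
        using m mx by (intro induced_path_Cons[OF sub]) (auto simp: nb_def)
      then show ?thesis using p m S
        by (intro exI[of _ "case_nat a (\<lambda>i. p (i + m))"] exI[of _ "Suc (k - m)"])
          (auto split: nat.splits)
    qed
  qed
  then show ?thesis using that by blast
qed

section \<open>Toll walks and asteroidal triples in terms of reachability\<close>

lemma vwalk_map_upt:
  assumes "\<And>i. i \<le> n \<Longrightarrow> f i \<in> pverts G" "\<And>i. i < n \<Longrightarrow> adj (f i) (f (Suc i))"
  shows "vwalk (map f [0..<Suc n]) (with_proj G)"
  using assms
proof (induction n)
  case (Suc n)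
  then have "vwalk (map f [0..<Suc n]) (with_proj G)" by simp
  moreover have "last (map f [0..<Suc n]) = f n" by simp
  ultimately show ?case using Suc.prems set_vwalk_arcs_snoc[of "map f [0..<Suc n]" "f (Suc n)"]
    by (subst upt_Suc_append) (auto simp: vwalk_def simp del: upt_Suc)
qed (simp add: vwalk_def)

lemma vwalk_nth:
  assumes "vwalk p (with_proj G)" "Suc i < length p"
  shows "adj (p ! i) (p ! Suc i)"
proof -
  have "set (vwalk_arcs p) \<subseteq> parcs G" using assms by (auto simp: vwalk_def)
  then show ?thesis using assms(2)
  proof (induction p arbitrary: i rule: vwalk_arcs.induct)
    case (3 x y xs)
    then show ?case by (cases i) auto
  qed auto
qed

lemma toll_walk_rev:
  assumes "toll_walk (with_proj G) p"
  shows "toll_walk (with_proj G) (rev p)"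
proof -
  let ?n = "length p"
  have p: "vwalk p (with_proj G)" "2 \<le> ?n" "hd p \<noteq> last p"
    "\<And>i. i < ?n \<Longrightarrow> adj (hd p) (p ! i) \<longleftrightarrow> i = 1"
    "\<And>i. i < ?n \<Longrightarrow> adj (last p) (p ! i) \<longleftrightarrow> i = ?n - 2"
    using assms by (auto simp: toll_walk_def)
  have "vwalk (map (\<lambda>i. rev p ! i) [0..<Suc (?n - 1)]) (with_proj G)"
  proof (rule vwalk_map_upt)
    fix i assume "i \<le> ?n - 1"
    then have "rev p ! i \<in> set (rev p)" using p(2) by (intro nth_mem) simp
    then show "rev p ! i \<in> pverts G" using p by (auto simp: vwalk_def)
  next
    fix i assume "i < ?n - 1"
    then show "adj (rev p ! i) (rev p ! Suc i)"
      using vwalk_nth[OF p(1), of "?n - Suc (Suc i)"] adj_sym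
      by (simp add: rev_nth Suc_diff_Suc)
  qed
  moreover have "Suc (?n - 1) = length (rev p)" using p(2) by simp
  ultimately have "vwalk (rev p) (with_proj G)" by (simp only: map_nth)
  moreover have "adj (last p) (rev p ! i) \<longleftrightarrow> i = 1" if "i < ?n" for i
    using p(2) p(5)[of "?n - Suc i"] that by (auto simp: rev_nth)
  moreover have "adj (hd p) (rev p ! i) \<longleftrightarrow> i = ?n - 2" if "i < ?n" for i
    using p(2) p(4)[of "?n - Suc i"] that by (auto simp: rev_nth)
  ultimately show ?thesis using p
    by (auto simp: toll_walk_def hd_rev last_rev)
qed

lemma toll_walk_reach:
  assumes p: "toll_walk (with_proj G) p" and i: "0 < i" "i < length p"
  shows "reach (nb (hd p)) (p ! i) (last p)"
proof -
  let ?u = "hd p"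
  have u: "adj ?u (p ! j) \<longleftrightarrow> j = 1" if "j < length p" for j
    using p that by (auto simp: toll_walk_def)
  have step: "adj (p ! j) (p ! Suc j)" if "Suc j < length p" for j
    using p that vwalk_nth by (auto simp: toll_walk_def)
  have lst: "last p = p ! (length p - 1)" "?u \<noteq> last p"
    using p by (auto simp: toll_walk_def last_conv_nth)
  \<comment> \<open>At a return to \<open>?u\<close>, the vertices just before and just after would
    both be neighbours of \<open>?u\<close>, but only position 1 holds one. The later vertex exists
    because the walk does not end in \<open>?u\<close>.\<close>
  have nu: "p ! Suc j \<notin> nb ?u" if j: "0 < j" "Suc j < length p" for j
  proof
    assume "p ! Suc j \<in> nb ?u"
    then have eq: "p ! Suc j = ?u" using u j by (auto simp: nb_def)
    with step[OF j(2)] u[of j] j have "j = 1" by (auto simp: adj_commute)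
    have "Suc (Suc j) < length p" using eq lst j by (metis Suc_lessI diff_Suc_1)
    with step[of "Suc j"] eq u[of "Suc (Suc j)"] show False by simp
  qed
  have "reach (nb ?u) (p ! i) (p ! (i + m))" if "i + m < length p" for m
    using that
  proof (induction m)
    case (Suc m)
    then show ?case using step[of "i + m"] nu[of "i + m"] i
      by (auto intro: reach_trans reach_step)
  qed simp
  from this[of "length p - 1 - i"] show ?thesis using i lst by simp
qed

lemma toll_walk_imp_toll:
  assumes p: "toll_walk (with_proj G) p" and x: "x \<in> set p" "x \<noteq> hd p" "x \<noteq> last p"
    and na: "\<not> adj (hd p) (last p)"
  shows "toll (hd p) (last p) x"
proof -
  obtain i where i: "i < length p" "x = p ! i" using x by (auto simp: in_set_conv_nth)
  have ne: "p \<noteq> []" using p by (auto simp: toll_walk_def)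
  have "0 < i" using i x ne by (metis gr0I hd_conv_nth)
  moreover have "i < length p - 1" using i x ne
    by (metis Suc_lessI diff_Suc_1 last_conv_nth less_diff_conv Suc_eq_plus1)
  moreover have "x = rev p ! (length p - 1 - i)" using i by (simp add: rev_nth)
  ultimately show ?thesis
    using toll_walk_reach[OF p, of i] toll_walk_reach[OF toll_walk_rev[OF p], of "length p - 1 - i"]
      i x na ne p by (auto simp: toll_def hd_rev last_rev nb_def toll_walk_def)
qed

text \<open>Two induced paths are glued at \<open>x\<close>, one to \<open>u\<close> outside
  \<open>nb v\<close> and one to \<open>v\<close> outside \<open>nb u\<close>. On its own path each
  end has just one neighbour, and the other path adds none beyond \<open>x\<close>.\<close>

lemma toll_imp_toll_walk:
  assumes t: "toll u v x" and x: "x \<in> pverts G"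
  obtains p where "toll_walk (with_proj G) p" "hd p = u" "last p = v" "x \<in> set p"
proof -
  obtain p k where p: "induced_path p k" "p 0 = x" "p k = u" "\<And>i. 0 < i \<Longrightarrow> i \<le> k \<Longrightarrow> p i \<notin> nb v"
    using reach_induced_path[of "nb v" x u] t x unfolding toll_def by metis
  obtain q l where q: "induced_path q l" "q 0 = x" "q l = v" "\<And>i. 0 < i \<Longrightarrow> i \<le> l \<Longrightarrow> q i \<notin> nb u"
    using reach_induced_path[of "nb u" x v] t x unfolding toll_def by metis
  have kl: "k > 0" "l > 0" using p q t by (auto simp: toll_def intro: gr0I)
  define f where "f i = (if i \<le> k then p (k - i) else q (i - k))" for i
  define w where "w = map f [0..<Suc (k + l)]"
  have fk: "f i = q (i - k)" if "k \<le> i" for i using that p q by (auto simp: f_def)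
  have vw: "vwalk w (with_proj G)" unfolding w_def
  proof (rule vwalk_map_upt)
    show "f i \<in> pverts G" if "i \<le> k + l" for i
      using that p q by (auto simp: f_def induced_pathD)
    show "adj (f i) (f (Suc i))" if "i < k + l" for i
    proof (cases "i < k")
      case True
      then show ?thesis using induced_pathD(3)[OF p(1), of "k - i" "k - Suc i"]
        by (simp add: f_def Suc_diff_Suc)
    next
      case False
      then show ?thesis using induced_pathD(3)[OF q(1), of "i - k" "Suc i - k"] that
        by (simp add: fk Suc_diff_le)
    qed
  qed
  have len: "length w = Suc (k + l)" by (simp add: w_def)
  have nth: "w ! i = f i" if "i \<le> k + l" for i using that by (simp add: w_def del: upt_Suc)
  have hd: "hd w = u" using nth[of 0] p len by (simp add: f_def hd_conv_nth flip: length_greater_0_conv)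
  have last: "last w = v" using nth[of "k + l"] q fk len
    by (simp add: last_conv_nth flip: length_greater_0_conv)
  have 1: "adj u (w ! i) \<longleftrightarrow> i = 1" if "i < length w" for i
  proof (cases "i \<le> k")
    case True
    then show ?thesis using induced_pathD(3)[OF p(1), of k "k - i"] that len p kl
      by (auto simp: nth f_def)
  next
    case False
    then show ?thesis using q(4)[of "i - k"] that len kl by (auto simp: nth f_def nb_def)
  qed
  have 2: "adj v (w ! i) \<longleftrightarrow> i = length w - 2" if "i < length w" for i
  proof (cases "i < k")
    case True
    then show ?thesis using p(4)[of "k - i"] that len kl by (auto simp: nth f_def nb_def)
  next
    case False
    then show ?thesis using induced_pathD(3)[OF q(1), of l "i - k"] that len q kl
      by (auto simp: nth fk)
  qed
  have "toll_walk (with_proj G) w"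
    using vw hd last 1 2 len kl t by (auto simp: toll_walk_def toll_def)
  moreover have "x \<in> set w" using nth[of k] len p by (metis diff_self_eq_0 f_def le_add1 le_imp_less_Suc nth_mem order_refl)
  ultimately show ?thesis using that hd last by blast
qed

lemma toll_verts: "toll u v x \<Longrightarrow> x \<in> pverts G"
  unfolding toll_def reach_def by (metis (no_types, lifting) adj_verts converse_rtranclpE)

text \<open>Without a toll vertex there is no toll walk, since its second vertex would be one; the
  set then lacks even \<open>u\<close> and \<open>v\<close>.\<close>

lemma toll_transit_nonadjacent:
  assumes "v \<notin> nb u"
  shows "toll_transit (with_proj G) u v =
    (if \<exists>x. toll u v x then insert u (insert v {x. toll u v x}) else {})"
proof -
  have uv: "u \<noteq> v" "\<not> adj u v" using assms by (auto simp: nb_def)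
  have ex: "\<exists>x. toll u v x" if "toll_walk (with_proj G) p" "hd p = u" "last p = v" for p
  proof -
    have p1: "1 < length p" "adj u (p ! 1)" using that by (auto simp: toll_walk_def)
    then have "p ! 1 \<noteq> u" "p ! 1 \<noteq> v" using uv by auto
    then show ?thesis using toll_walk_imp_toll[OF that(1), of "p ! 1"] p1 that uv by auto
  qed
  show ?thesis
  proof (intro set_eqI iffI)
    fix x assume "x \<in> toll_transit (with_proj G) u v"
    then obtain p where p: "toll_walk (with_proj G) p" "hd p = u" "last p = v" "x \<in> set p"
      using uv by (auto simp: toll_transit_def)
    then show "x \<in> (if \<exists>x. toll u v x then insert u (insert v {x. toll u v x}) else {})"
      using ex[OF p(1-3)] toll_walk_imp_toll[OF p(1,4)] uv by auto
  next
    fix x assume x: "x \<in> (if \<exists>x. toll u v x then insert u (insert v {x. toll u v x}) else {})"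
    then obtain y where y: "toll u v y" "x = u \<or> x = v \<or> x = y" by (auto split: if_splits)
    obtain p where p: "toll_walk (with_proj G) p" "hd p = u" "last p = v" "y \<in> set p"
      using toll_imp_toll_walk[OF y(1) toll_verts[OF y(1)]] .
    then have "p \<noteq> []" by auto
    then have "x \<in> set p" using p y(2) by (metis hd_in_set last_in_set)
    then show "x \<in> toll_transit (with_proj G) u v" using p uv by (auto simp: toll_transit_def)
  qed
qed

text \<open>The last vertex is itself a neighbour of the first, so it stands at position 1 of every
  toll walk.\<close>

lemma toll_transit_adjacent:
  assumes "adj u v"
  shows "toll_transit (with_proj G) u v = {u, v}"
proof -
  have uv: "u \<noteq> v" using assms by auto
  have "toll_walk (with_proj G) [u, v]"
    using assms adj_sym adj_verts by (auto simp: toll_walk_def vwalk_def less_Suc_eq)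
  moreover have "x \<in> {u, v}" if p: "toll_walk (with_proj G) p" "hd p = u" "last p = v" "x \<in> set p" for p x
  proof -
    have "2 \<le> length p" "last p = p ! (length p - 1)" using p by (auto simp: toll_walk_def last_conv_nth)
    then have "length p - 1 = 1" using p assms by (auto simp: toll_walk_def)
    then have "length p = 2" by simp
    then obtain a b where "p = [a, b]" by (metis One_nat_def Suc_1 length_0_conv length_Suc_conv)
    then show ?thesis using p by auto
  qed
  ultimately show ?thesis using uv by (fastforce simp: toll_transit_def)
qed

text \<open>A path without neighbours of \<open>c\<close> cannot enter \<open>c\<close> either: it
  does not start there, and the vertex before \<open>c\<close> would be a neighbour.\<close>

lemma path_avoiding_nbrs_iff:
  assumes "a \<in> pverts G" "a \<noteq> c"
  shows "path_avoiding_nbrs (with_proj G) a b c \<longleftrightarrow> conn c a b"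
proof
  assume "path_avoiding_nbrs (with_proj G) a b c"
  then obtain p where p: "vwalk p (with_proj G)" "hd p = a" "last p = b" "\<forall>x\<in>set p. \<not> adj c x"
    by (auto simp: path_avoiding_nbrs_def vpath_def)
  then have ne: "p \<noteq> []" by (auto simp: vwalk_def)
  have "reach (nb c) a (p ! j)" if "j < length p" for j
    using that
  proof (induction j)
    case 0
    then show ?case using p ne by (simp add: hd_conv_nth)
  next
    case (Suc j)
    have "adj (p ! j) (p ! Suc j)" using vwalk_nth p Suc by blast
    moreover have "\<not> adj c (p ! j)" "\<not> adj c (p ! Suc j)" using p Suc by auto
    ultimately have "reach (nb c) (p ! j) (p ! Suc j)"
      by (intro reach_step) (auto simp: nb_def dest: adj_sym)
    then show ?case using Suc by (auto intro: reach_trans)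
  qed
  from this[of "length p - 1"] have "reach (nb c) a b" using ne p by (simp add: last_conv_nth)
  moreover have "\<not> adj c a" using p ne by auto
  ultimately show "conn c a b" using assms by (auto simp: conn_def nb_def)
next
  assume c: "conn c a b"
  then obtain p k where p: "induced_path p k" "p 0 = a" "p k = b" "\<And>i. 0 < i \<Longrightarrow> i \<le> k \<Longrightarrow> p i \<notin> nb c"
    using reach_induced_path[of "nb c" a b] assms unfolding conn_def by metis
  have "p i \<notin> nb c" if "i \<le> k" for i using p c that by (cases "i = 0") (auto simp: conn_def)
  moreover have "vwalk (map p [0..<Suc k]) (with_proj G)"
    using p by (intro vwalk_map_upt) (auto simp: induced_pathD)
  moreover have "distinct (map p [0..<Suc k])"
    using induced_pathD(2)[OF p(1)] by (auto simp: distinct_map inj_on_def simp del: upt_Suc)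
  moreover have "hd (map p [0..<Suc k]) = a" using p by (simp add: hd_map del: upt_Suc)
  moreover have "last (map p [0..<Suc k]) = b" using p by simp
  ultimately show "path_avoiding_nbrs (with_proj G) a b c"
    unfolding path_avoiding_nbrs_def vpath_def
    by (intro exI[of _ "map p [0..<Suc k]"]) (auto simp: nb_def simp del: upt_Suc)
qed

lemma AT_free_iff:
  "AT_free (with_proj G) \<longleftrightarrow>
     (\<nexists>a b c. {a, b, c} \<subseteq> pverts G \<and> conn c a b \<and> conn a b c \<and> conn b a c)"
proof -
  have "asteroidal_triple (with_proj G) a b c \<longleftrightarrow>
      {a, b, c} \<subseteq> pverts G \<and> conn c a b \<and> conn a b c \<and> conn b a c" for a b c
  proof (cases "{a, b, c} \<subseteq> pverts G \<and> a \<noteq> b \<and> b \<noteq> c \<and> a \<noteq> c")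
    case True
    then show ?thesis by (auto simp: asteroidal_triple_def path_avoiding_nbrs_iff)
  next
    case False
    then show ?thesis by (auto simp: asteroidal_triple_def dest!: conn_nb)
  qed
  then show ?thesis by (simp add: AT_free_def)
qed

section \<open>Cutting walks at a last or first visit\<close>

text \<open>Cut at the last vertex in \<open>nb x\<close>. It is not \<open>x\<close>, because a
  walk leaving \<open>x\<close> steps into \<open>nb x\<close> at once.\<close>

lemma reach_last_exit:
  assumes "reach S x v" "x \<noteq> v"
  obtains m where "adj x m" "m \<notin> S" "reach (S \<union> nb x) m v"
proof -
  have *: "\<not> reach (S \<union> nb x) x v"
  proof
    assume "reach (S \<union> nb x) x v"
    then show False unfolding reach_def
      by (rule converse_rtranclpE) (use assms(2) in \<open>auto simp: nb_def\<close>)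
  qed
  then obtain m where "m \<in> nb x" "m \<notin> S" "reach (S \<union> nb x) m v"
    using reach_last_hit[OF assms(1), of "nb x"] by blast
  moreover from this have "m \<noteq> x" using * by blast
  ultimately show ?thesis using that by (auto simp: nb_def)
qed

lemma reach_first_hit:
  assumes "reach S a b" "b \<in> D" "a \<notin> D"
  obtains k m where "reach (S \<union> D) a k" "adj k m" "m \<in> D" "m \<notin> S"
proof -
  have "reach (S \<union> D) a b \<or> (\<exists>k m. reach (S \<union> D) a k \<and> adj k m \<and> m \<in> D \<and> m \<notin> S)"
    using assms(1) unfolding reach_def
  proof (induction rule: rtranclp_induct)
    case (step y z)
    then show ?case
      by (cases "z \<in> D") (blast, auto intro: rtranclp.rtrancl_into_rtrancl)
  qed simp
  then show ?thesis using that reach_end[of "S \<union> D" a b] assms by blast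
qed

lemma reach_closed:
  assumes "reach S a b" "a \<in> K" "\<And>y z. y \<in> K \<Longrightarrow> adj y z \<Longrightarrow> z \<notin> S \<Longrightarrow> z \<in> K"
  shows "reach (- K) a b" "b \<in> K"
proof -
  have "reach (- K) a b \<and> b \<in> K"
    using assms(1) unfolding reach_def
  proof (induction rule: rtranclp_induct)
    case (step y z)
    then have "z \<in> K" using assms(3) by blast
    with step show ?case by (auto intro: rtranclp.rtrancl_into_rtrancl)
  qed (use assms(2) in simp)
  then show "reach (- K) a b" "b \<in> K" by blast+
qed

lemma toll_commute: "toll u v x \<longleftrightarrow> toll v u x"
  by (auto simp: toll_def nb_commute)

lemma toll_conn: "toll u v x \<Longrightarrow> x \<notin> nb u \<Longrightarrow> conn u x v"
  by (simp add: toll_def conn_def)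

lemma toll_conn': "toll u v x \<Longrightarrow> x \<notin> nb v \<Longrightarrow> conn v x u"
  by (simp add: toll_def conn_def)

lemma conn_toll: "v \<notin> nb u \<Longrightarrow> conn u x v \<Longrightarrow> conn v x u \<Longrightarrow> toll u v x"
  by (auto simp: toll_def conn_def)

end

section \<open>Toll vertices in AT-free graphs\<close>

locale at_free_graph = pair_graph +
  assumes at_free:
    "\<lbrakk>a \<in> pverts G; b \<in> pverts G; c \<in> pverts G; conn c a b; conn a b c; conn b a c\<rbrakk> \<Longrightarrow> False"
begin

text \<open>Otherwise \<open>u\<close>, \<open>v\<close>, \<open>x\<close> form an asteroidal
  triple: \<open>toll u v x\<close> joins \<open>x\<close> to \<open>v\<close> outside
  \<open>nb u\<close> and to \<open>u\<close> outside \<open>nb v\<close>, and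
  \<open>toll u x v\<close> joins \<open>v\<close> to \<open>u\<close> outside
  \<open>nb x\<close>.\<close>

lemma toll_b1':
  assumes "toll u v x" "x \<notin> nb v" "u \<in> pverts G" "v \<in> pverts G"
  shows "\<not> toll u x v"
proof
  assume t: "toll u x v"
  then have "v \<notin> nb u" "x \<notin> nb u" using assms(1) by (auto simp: toll_def)
  then have "conn v x u" "conn u x v" "conn x v u"
    using assms t nb_commute by (auto intro: toll_conn toll_conn')
  then show False using at_free[of x u v] assms conn_sym toll_verts by blast
qed

text \<open>Outside \<open>nb v\<close>, \<open>y\<close> reaches \<open>u\<close> through
  \<open>x\<close>. If \<open>y\<close> could not reach \<open>v\<close> outside
  \<open>nb u\<close>, its walks to \<open>v\<close> outside \<open>nb x\<close> and to
  \<open>x\<close> outside \<open>nb v\<close> would both meet \<open>nb u\<close>; restarting them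
  at \<open>u\<close> makes \<open>x\<close>, \<open>u\<close>, \<open>v\<close> asteroidal.\<close>

lemma toll_b2':
  assumes x: "toll u v x" "x \<notin> nb u" and y: "toll x v y" "y \<noteq> u"
    and V: "u \<in> pverts G" "v \<in> pverts G"
  shows "toll u v y"
proof -
  have vy: "reach (nb v) y u" using x y reach_trans unfolding toll_def by blast
  have uxv: "conn u x v" using x by (rule toll_conn)
  have "reach (nb u) y v"
  proof (rule ccontr)
    assume n: "\<not> reach (nb u) y v"
    then have "\<not> reach (nb u) y x" using uxv reach_trans unfolding conn_def by blast
    with n have "reach (nb x) u v" "reach (nb v) u x"
      using y reach_hit_nb unfolding toll_def by blast+
    then have "conn x u v" "conn v u x" using x nb_commute by (auto simp: conn_def toll_def)
    then show False using at_free[of x u v] uxv x(1) V conn_sym toll_verts by blast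
  qed
  then show ?thesis using x y vy by (auto simp: toll_def)
qed

text \<open>If \<open>x\<close> cannot reach \<open>u\<close> outside \<open>nb v\<close>, then
  \<open>x\<close>, \<open>v\<close>, \<open>y\<close> is an asteroidal triple; if it cannot reach
  \<open>v\<close> outside \<open>nb u\<close>, then \<open>u\<close>, \<open>y\<close>,
  \<open>x\<close> is one. The missing walk comes from \<open>reach_hit_nb\<close> each
  time.\<close>

lemma toll_J4':
  assumes x: "toll u y x" and y: "toll x v y"
    and n: "x \<notin> nb u" "y \<notin> nb v" "x \<notin> nb y" "v \<notin> nb u" and V: "u \<in> pverts G" "v \<in> pverts G"
  shows "toll u v x"
proof -
  have V': "x \<in> pverts G" "y \<in> pverts G" using x y toll_verts by blast+
  have nn: "y \<notin> nb u" "x \<notin> nb v" using x y nb_commute by (auto simp: toll_def)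
  have c: "conn u x y" "conn y x u" "conn x y v" "conn v y x"
    using x y n nn nb_commute by (auto intro: toll_conn toll_conn')
  have "conn v x u"
  proof (rule ccontr)
    assume "\<not> conn v x u"
    then have "\<not> reach (nb v) x u" using nn by (simp add: conn_def)
    then have "reach (nb y) v u" using c reach_hit_nb unfolding conn_def by blast
    then have "conn y v u" using n nb_commute by (auto simp: conn_def)
    then have "conn y x v" using c conn_sym conn_trans by blast
    then show False using at_free[of x v y] c V V' conn_sym by blast
  qed
  moreover have "conn u x v"
  proof (rule ccontr)
    assume "\<not> conn u x v"
    then have "\<not> reach (nb u) y v" using c conn_trans nn by (auto simp: conn_def intro: reach_trans)
    then have "reach (nb x) u v" using c reach_hit_nb unfolding conn_def by blast
    then have "conn x u v" using n nb_commute by (auto simp: conn_def)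
    then have "conn x y u" using c conn_sym conn_trans by blast
    then show False using at_free[of u y x] c V V' conn_sym by blast
  qed
  ultimately show ?thesis using n by (simp add: conn_toll)
qed

text \<open>The neighbour \<open>c\<close> of \<open>x\<close> is chosen so that the component of \<open>v\<close> outside the closed
  neighbourhood of \<open>c\<close> is minimal: if \<open>x\<close> were a toll vertex between \<open>c\<close> and \<open>v\<close>, the last
  neighbour of \<open>x\<close> on a walk from \<open>x\<close> to \<open>v\<close> avoiding \<open>c\<close> would have a smaller component.\<close>

lemma toll_TWA:
  assumes t: "toll u v x" and n: "x \<notin> nb v" and V: "u \<in> pverts G" "v \<in> pverts G"
  obtains c where "adj x c" "c \<notin> nb u" "toll u v c" "toll x v c" "\<not> toll c v x"
    "\<And>y. toll c v y \<Longrightarrow> toll x v y"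
proof -
  define Cand where "Cand = {c. adj x c \<and> c \<notin> nb u \<and> reach (nb u) c v \<and> reach (nb x) c v}"
  have xv: "x \<noteq> v" and nx: "v \<notin> nb x" using n nb_commute by auto
  have candI: "m \<in> Cand" if "adj x m" "m \<notin> S" "reach (S \<union> nb x) m v" "nb u \<subseteq> S" for m S
    using that by (auto simp: Cand_def intro: reach_mono)
  obtain c0 where c0: "c0 \<in> Cand"
    using reach_last_exit[of "nb u" x v] t xv candI unfolding toll_def by (metis order_refl)
  have cvx: "reach (nb v) c x" if "adj x c" for c using that n by (auto intro: reach_step adj_sym)
  have cand: "adj x c" "c \<notin> nb u" "toll u v c" "toll x v c" if "c \<in> Cand" for c
  proof -
    have "adj x c" "c \<noteq> v" using that nx by (auto simp: Cand_def nb_def)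
    then show "adj x c" "c \<notin> nb u" "toll u v c" "toll x v c"
      using that t nx cvx[of c] by (auto simp: Cand_def toll_def intro: reach_trans)
  qed
  show ?thesis
  proof (cases "\<exists>c\<in>Cand. v \<in> nb c")
    \<comment> \<open>Here \<open>toll c v\<close> is empty, because it requires \<open>v\<close> to
      lie outside \<open>nb c\<close>.\<close>
    case True
    then obtain c where "c \<in> Cand" "v \<in> nb c" by blast
    then show ?thesis using that[of c] cand[of c] by (auto simp: toll_def)
  next
    case False
    define S where "S c = {z \<in> pverts G. reach (nb c) v z}" for c
    obtain c where c: "c \<in> Cand" and min: "\<And>d. d \<in> Cand \<Longrightarrow> card (S c) \<le> card (S d)"
      using ex_has_least_nat[of "\<lambda>c. c \<in> Cand" c0 "\<lambda>c. card (S c)"] c0 by blast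
    have cv: "v \<notin> nb c" "c \<notin> nb v" using False c nb_commute by auto
    have nr: "\<not> reach (nb c) x v"
    proof
      assume r: "reach (nb c) x v"
      have cV: "c \<in> pverts G" using cand(3)[OF c] toll_verts by blast
      have "\<not> reach (nb c) u v"
      proof
        assume "reach (nb c) u v"
        then have "conn c u v" using cand(2)[OF c] nb_commute by (auto simp: conn_def)
        moreover have "conn u c v" "conn v c u"
          using cand[OF c] cv by (auto intro: toll_conn toll_conn')
        ultimately show False using at_free[of c u v] V cV conn_sym by blast
      qed
      \<comment> \<open>Had the walk met \<open>nb u\<close>, then \<open>u\<close> would reach
        \<open>v\<close> outside \<open>nb c\<close>, which was just excluded. So it avoids both
        sets, and its last exit from \<open>nb x\<close> is again a candidate.\<close>
      then have "reach (nb c \<union> nb u) x v"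
        using reach_last_hit[OF r, of "nb u"] reach_mono
        by (smt (verit) Un_upper1 mem_Collect_eq nb_def insert_iff reach_trans reach_step)
      then obtain m where m: "adj x m" "m \<notin> nb c \<union> nb u" "reach (nb c \<union> nb u \<union> nb x) m v"
        using reach_last_exit xv by blast
      then have mC: "m \<in> Cand" by (intro candI[of m "nb c \<union> nb u"]) auto
      have mv: "v \<notin> nb m" "m \<notin> nb v" using False mC nb_commute by auto
      have cm: "conn c m v" using m by (auto simp: conn_def intro: reach_mono)
      have ncm: "\<not> reach (nb m) c v"
      proof
        assume "reach (nb m) c v"
        then have "conn m c v" using m nb_commute by (auto simp: conn_def)
        moreover have "reach (nb v) c m"
          using cvx[OF cand(1)[OF c]] reach_step[OF m(1) mv(2)] reach_trans by blast
        then have "conn v c m" using cv by (auto simp: conn_def)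
        ultimately show False
          using at_free[of c m v] cm V cV conn_sym adj_verts[OF m(1)] by blast
      qed
      \<comment> \<open>A walk to \<open>v\<close> outside \<open>nb m\<close> cannot meet
        \<open>nb c\<close>, or \<open>c\<close> would reach \<open>v\<close> outside
        \<open>nb m\<close>. The inclusion is strict because of \<open>m\<close>.\<close>
      have "S m \<subseteq> S c"
      proof
        fix z assume z: "z \<in> S m"
        then have zv: "reach (nb m) z v" "z \<notin> nb m"
          using mv reach_sym reach_end unfolding S_def by blast+
        have "reach (nb c) z v" using reach_hit_nb[OF zv(1)] ncm by blast
        moreover have "z \<notin> nb c"
          using ncm zv by (auto simp: nb_def[of c] intro: reach_trans reach_step)
        ultimately have "reach (nb c) v z" by (rule reach_sym)
        then show "z \<in> S c" using z by (simp add: S_def)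
      qed
      moreover have "m \<in> S c" using conn_sym[OF cm] adj_verts[OF m(1)] by (simp add: S_def conn_def)
      moreover have "m \<notin> S m" using reach_end[of "nb m" v m] mv by (auto simp: S_def)
      ultimately have "card (S m) < card (S c)"
        by (intro psubset_card_mono) (auto simp: S_def)
      then show False using min[OF mC] by simp
    qed
    have "toll x v y" if "toll c v y" for y
    proof -
      have "reach (nb x) y v" using reach_hit_nb[of "nb c" y v x] nr that by (auto simp: toll_def)
      moreover have "reach (nb v) y x" using that cvx[OF cand(1)[OF c]] reach_trans
        unfolding toll_def by blast
      moreover have "y \<noteq> x" using that nr by (auto simp: toll_def)
      ultimately show ?thesis using that nx by (auto simp: toll_def)
    qed
    moreover have "\<not> toll c v x" using nr by (simp add: toll_def)
    ultimately show ?thesis using that cand[OF c] by blast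
  qed
qed

end

section \<open>Transit functions given by toll intervals satisfy the axioms\<close>

locale transit =
  fixes V :: "'a set" and R :: "'a \<Rightarrow> 'a \<Rightarrow> 'a set"
  assumes finite_V: "finite V" and transit: "transit_function V R"
begin

sublocale pair_graph "underlying_graph V R"
  using finite_V transit by (rule pair_graph_underlying_graph)

lemma pverts_underlying [simp]: "pverts (underlying_graph V R) = V"
  by (simp add: underlying_graph_def)

lemma R_sub: "u \<in> V \<Longrightarrow> v \<in> V \<Longrightarrow> R u v \<subseteq> V"
  using transit by (simp add: transit_function_def)

lemma R_commute: "u \<in> V \<Longrightarrow> v \<in> V \<Longrightarrow> R u v = R v u"
  using transit by (simp add: transit_function_def)

lemma R_self [simp]: "u \<in> V \<Longrightarrow> R u u = {u}"
  using transit by (simp add: transit_function_def)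

lemma R_ends [simp]: "u \<in> V \<Longrightarrow> v \<in> V \<Longrightarrow> u \<in> R u v" "u \<in> V \<Longrightarrow> v \<in> V \<Longrightarrow> v \<in> R u v"
  using transit by (metis transit_function_def)+

lemma adj_iff: "adj a b \<longleftrightarrow> a \<in> V \<and> b \<in> V \<and> a \<noteq> b \<and> R a b = {a, b}"
  by (simp add: underlying_graph_def)

lemma R_eq_iff: "a \<in> V \<Longrightarrow> b \<in> V \<Longrightarrow> R a b = {a, b} \<longleftrightarrow> b \<in> nb a"
  by (auto simp: nb_def adj_iff)

text \<open>This differs from \<open>toll_transit\<close> only for non-adjacent \<open>u\<close> and
  \<open>v\<close> without a toll walk, where it is \<open>{u, v}\<close> instead of empty.\<close>

definition interval :: "'a \<Rightarrow> 'a \<Rightarrow> 'a set" where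
  "interval u v = insert u (insert v {x. toll u v x})"

text \<open>(J2), (J4) and (TW1') come from splicing walks. AT-freeness enters through
  \<open>toll_b1'\<close>, \<open>toll_b2'\<close>, \<open>toll_J4'\<close> and
  \<open>toll_TWA\<close>.\<close>

lemma interval_axioms:
  assumes at: "at_free_graph (underlying_graph V R)"
    and R: "\<And>u v. u \<in> V \<Longrightarrow> v \<in> V \<Longrightarrow> R u v = interval u v"
  shows "ax_b1' V R" "ax_b2' V R" "ax_J2 V R" "ax_J4 V R" "ax_J4' V R" "ax_TW1' V R" "ax_TWA V R"
proof -
  interpret at_free_graph "underlying_graph V R" by (rule at)
  have mem: "x \<in> R u v \<longleftrightarrow> x = u \<or> x = v \<or> toll u v x" if "u \<in> V" "v \<in> V" for u v x
    using R[OF that] by (auto simp: interval_def)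
  have tollD: "x \<noteq> u" "x \<noteq> v" "v \<notin> nb u" "u \<noteq> v" "reach (nb u) x v" "reach (nb v) x u"
    if "toll u v x" for u v x using that by (auto simp: toll_def)
  show "ax_b1' V R" unfolding ax_b1'_def
  proof (intro ballI impI)
    fix u v x assume V: "u \<in> V" "v \<in> V" "x \<in> V" and h: "x \<in> R u v \<and> v \<noteq> x \<and> R v x \<noteq> {v, x}"
    then have n: "x \<notin> nb v" by (simp add: R_eq_iff)
    show "v \<notin> R u x"
    proof
      assume "v \<in> R u x"
      moreover have "v \<noteq> u" "x \<noteq> u" using calculation h V by auto
      ultimately have "toll u v x" "toll u x v" using h V mem by blast+
      then show False using toll_b1' n V by simp
    qed
  qed
  show "ax_b2' V R" unfolding ax_b2'_def
  proof (intro ballI impI subsetI)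
    fix u v x y assume V: "u \<in> V" "v \<in> V" "x \<in> V" and h: "x \<in> R u v \<and> R u x \<noteq> {u, x}" "y \<in> R x v"
    then have n: "x \<notin> nb u" by (simp add: R_eq_iff)
    then have "x = v \<or> toll u v x" using h(1) V mem[of u v x] by auto
    then show "y \<in> R u v" using h n V toll_b2'[of u v x y] mem[of x v y] mem[of u v y] by auto
  qed
  show "ax_J2 V R" unfolding ax_J2_def
  proof (intro ballI impI)
    fix u v x assume V: "u \<in> V" "v \<in> V" "x \<in> V"
      and "R u x = {u, x} \<and> R x v = {x, v} \<and> u \<noteq> v \<and> R u v \<noteq> {u, v}"
    then have "x \<in> nb u" "v \<in> nb x" "u \<noteq> v" "v \<notin> nb u" by (auto simp: R_eq_iff)
    then have "x = u \<or> x = v \<or> toll u v x"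
      using nb_commute[of u v] by (auto simp: toll_def nb_def intro: reach_step adj_sym)
    then show "x \<in> R u v" using V by (simp add: mem)
  qed
  show "ax_J4 V R" unfolding ax_J4_def
  proof (intro ballI impI)
    fix u v x y assume V: "u \<in> V" "v \<in> V" "x \<in> V" "y \<in> V"
      and "x \<in> R u y \<and> y \<in> R x v \<and> x \<noteq> y \<and> R u x = {u, x} \<and> R y v = {y, v} \<and> R u v \<noteq> {u, v}"
    then have h: "x = u \<or> toll u y x" "x = v \<or> y = v \<or> toll x v y" "x \<in> nb u" "v \<in> nb y" "v \<notin> nb u" "x \<noteq> y"
      by (auto simp: R_eq_iff mem)
    have "toll u v x" if "x \<noteq> u" "x \<noteq> v"
    proof -
      have "toll u y x" using h that by blast
      then have "reach (nb u) x y" "v = y \<or> adj y v" "adj x u" "u \<notin> nb v"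
        using that h nb_commute by (auto simp: nb_def toll_def intro: adj_sym)
      then show ?thesis using that h by (auto simp: toll_def intro: reach_trans reach_step)
    qed
    then show "x \<in> R u v" using V by (auto simp: mem)
  qed
  show "ax_J4' V R" unfolding ax_J4'_def
  proof (intro ballI impI)
    fix u v x y assume V: "u \<in> V" "v \<in> V" "x \<in> V" "y \<in> V"
      and "x \<in> R u y \<and> y \<in> R x v \<and> R u x \<noteq> {u, x} \<and> R y v \<noteq> {y, v} \<and> R x y \<noteq> {x, y} \<and> R u v \<noteq> {u, v}"
    then have "toll u y x" "toll x v y" "x \<notin> nb u" "y \<notin> nb v" "x \<notin> nb y" "v \<notin> nb u"
      using nb_commute by (auto simp: R_eq_iff mem)
    then show "x \<in> R u v" using V toll_J4' by (auto simp: mem)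
  qed
  show "ax_TW1' V R" unfolding ax_TW1'_def
  proof (intro ballI impI)
    fix u v x y z w assume V: "u \<in> V" "v \<in> V" "x \<in> V" "y \<in> V" "z \<in> V" "w \<in> V"
      and "x \<in> R u v \<and> y \<in> R u v \<and> x \<noteq> u \<and> y \<noteq> v \<and> R x v \<noteq> {x, v} \<and> R u y \<noteq> {u, y} \<and>
        R x z = {x, z} \<and> R z w = {z, w} \<and> R w y = {w, y} \<and> R u w \<noteq> {u, w}"
    then have h: "toll u v x" "toll u v y" "x \<notin> nb v" "y \<notin> nb u" "z \<in> nb x" "w \<in> nb z" "y \<in> nb w" "w \<notin> nb u"
      using nb_commute by (auto simp: R_eq_iff mem)
    \<comment> \<open>The two walks from \<open>z\<close> are \<open>z, w, y\<close> and on to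
      \<open>v\<close> outside \<open>nb u\<close>, and \<open>z, x\<close> and on to
      \<open>u\<close> outside \<open>nb v\<close>.\<close>
    have "reach (nb u) w y" "reach (nb u) z w" "reach (nb v) z x"
      using h by (auto simp: nb_def[of w] nb_def[of z] nb_def[of x] intro: reach_step adj_sym)
    then have "reach (nb u) z v" "reach (nb v) z u"
      using h reach_trans unfolding toll_def by blast+
    then have "z = u \<or> z = v \<or> toll u v z" using h by (auto simp: toll_def)
    then show "z \<in> R u v" using V by (simp add: mem)
  qed
  show "ax_TWA V R" unfolding ax_TWA_def
  proof (intro ballI impI)
    fix u v x assume V: "u \<in> V" "v \<in> V" "x \<in> V" and "u \<noteq> v \<and> u \<noteq> x \<and> v \<noteq> x \<and> x \<in> R u v"
    then have t: "toll u v x" and ne: "u \<noteq> v" "x \<noteq> v" by (auto simp: mem)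
    show "\<exists>x1\<in>R x v \<inter> R u v. x1 \<noteq> x \<and> R x x1 = {x, x1} \<and> R u x1 \<noteq> {u, x1} \<and> R x1 v \<subset> R x v"
    proof (cases "x \<in> nb v")
      case True
      \<comment> \<open>The witness is \<open>v\<close> itself, as
        \<open>R v v = {v}\<close>.\<close>
      then show ?thesis using V t ne nb_commute
        by (intro bexI[of _ v]) (auto simp: R_eq_iff toll_def)
    next
      case False
      then obtain c where c: "adj x c" "c \<notin> nb u" "toll u v c" "toll x v c" "\<not> toll c v x"
        "\<And>y. toll c v y \<Longrightarrow> toll x v y"
        using toll_TWA[OF t] V by auto
      have cV: "c \<in> V" using c(1) adj_iff by blast
      have "R c v \<subseteq> R x v" using c V cV by (auto simp: mem)
      moreover have "x \<in> R x v" "x \<notin> R c v" using c V cV ne by (auto simp: mem)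
      moreover have "c \<in> R x v \<inter> R u v" "c \<noteq> x" "R x c = {x, c}" "R u c \<noteq> {u, c}"
        using c V cV by (auto simp: mem R_eq_iff nb_def)
      ultimately show ?thesis by (intro bexI[of _ c]) auto
    qed
  qed
qed

end

section \<open>From the axioms to toll intervals and AT-freeness\<close>

locale axiomatic_transit = transit +
  assumes b1': "ax_b1' V R" and J2: "ax_J2 V R" and J4: "ax_J4 V R"
    and J4': "ax_J4' V R" and TW1': "ax_TW1' V R" and TWA: "ax_TWA V R"
begin

text \<open>(TWA) yields a neighbour of \<open>x\<close> in \<open>R u v\<close>, outside
  \<open>nb u\<close> and with a smaller interval to \<open>v\<close>. Repeating this traces the
  walk.\<close>

lemma R_reach:
  assumes V: "u \<in> V" "v \<in> V" and "v \<notin> nb u" "x \<in> R u v" "x \<noteq> u"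
  shows "reach (nb u) x v"
  using assms(4,5)
proof (induction "card (R x v)" arbitrary: x rule: less_induct)
  case less
  show ?case
  proof (cases "x = v")
    case False
    have x: "x \<in> V" using less.prems R_sub[OF V] by blast
    have "u \<noteq> v" using assms(3) by auto
    then obtain y where y: "y \<in> R x v \<inter> R u v" "y \<noteq> x" "R x y = {x, y}" "R u y \<noteq> {u, y}" "R y v \<subset> R x v"
      using TWA less.prems False x V unfolding ax_TWA_def by metis
    have yV: "y \<in> V" using y(1) R_sub[OF V] by blast
    have "card (R y v) < card (R x v)"
      using R_sub[OF x V(2)] finite_V finite_subset y(5) by (blast intro: psubset_card_mono)
    moreover have "y \<notin> nb u" using y(4) V yV R_eq_iff by blast
    moreover from this have "y \<noteq> u" by auto
    ultimately have "reach (nb u) y v" using less.hyps y(1) by blast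
    moreover have "adj x y" using y x yV by (simp add: adj_iff)
    ultimately show ?thesis using \<open>y \<notin> nb u\<close> reach_trans reach_step by blast
  qed simp
qed

lemma R_sub_interval: "u \<in> V \<Longrightarrow> v \<in> V \<Longrightarrow> R u v \<subseteq> interval u v"
proof
  fix x assume V: "u \<in> V" "v \<in> V" and x: "x \<in> R u v"
  show "x \<in> interval u v"
  proof (cases "x = u \<or> x = v")
    case False
    have "v \<notin> nb u"
    proof
      assume "v \<in> nb u"
      then have "R u v = {u, v}" using R_eq_iff V by blast
      then show False using x False by simp
    qed
    then have "toll u v x"
      using False R_reach[OF V _ x] R_reach[OF V(2,1), of x] x R_commute[OF V] nb_commute
      by (auto simp: toll_def)
    then show ?thesis by (simp add: interval_def)
  qed (auto simp: interval_def)
qed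

text \<open>Membership in \<open>nb\<close> admits equality, so \<open>z\<close>, \<open>w\<close>,
  \<open>y\<close> may coincide. Such degenerate instances fill short gaps in paths and give
  \<open>core_neighbour\<close>.\<close>

lemma TW1'D:
  assumes "x \<in> R u v" "y \<in> R u v" "u \<in> V" "v \<in> V" "x \<noteq> u" "y \<noteq> v" "x \<notin> nb v" "y \<notin> nb u"
    "adj x z" "w \<in> nb z" "y \<in> nb w" "w \<notin> nb u"
  shows "z \<in> R u v"
proof -
  have "x \<in> V" "z \<in> V" "y \<in> V" using assms(1-4,9) R_sub adj_iff by blast+
  moreover from this have "w \<in> V" using assms(10) adj_iff by (auto simp: nb_def)
  moreover have "R x v \<noteq> {x, v}" "R u y \<noteq> {u, y}" "R x z = {x, z}" "R z w = {z, w}"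
    "R w y = {w, y}" "R u w \<noteq> {u, w}"
    using assms calculation nb_commute[of x v] R_eq_iff adj_iff by auto
  ultimately show ?thesis
    using assms(1-6) by (intro TW1'[unfolded ax_TW1'_def, rule_format, of u v x y z w]) blast+
qed

lemma J4D:
  assumes "x \<in> R u y" "y \<in> R x v" "x \<noteq> y" "adj u x" "adj y v" "v \<notin> nb u"
  shows "x \<in> R u v"
proof -
  have "u \<in> V" "x \<in> V" "v \<in> V" "y \<in> V" "R u x = {u, x}" "R y v = {y, v}"
    using assms(4,5) by (auto simp: adj_iff)
  moreover have "R u v \<noteq> {u, v}" using R_eq_iff calculation assms(6) by blast
  ultimately show ?thesis using J4 assms unfolding ax_J4_def by metis
qed

lemma J4'D:
  assumes "x \<in> R u y" "y \<in> R x v" "x \<notin> nb u" "v \<notin> nb y" "y \<notin> nb x" "v \<notin> nb u"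
    "u \<in> V" "v \<in> V" "x \<in> V" "y \<in> V"
  shows "x \<in> R u v"
proof -
  have "R u x \<noteq> {u, x}" "R y v \<noteq> {y, v}" "R x y \<noteq> {x, y}" "R u v \<noteq> {u, v}"
    using assms R_eq_iff by blast+
  then show ?thesis using J4' assms unfolding ax_J4'_def by metis
qed

text \<open>Induction on the length makes all shorter segments available. (J2) or (J4) gives the
  vertices next to the ends, (J4') those at distance at least 2 from one end and 4 from the other,
  and (TW1') the few left over.\<close>

lemma induced_path_R:
  assumes "induced_path p k" "i \<le> k"
  shows "p i \<in> R (p 0) (p k)"
  using assms
proof (induction k arbitrary: p i rule: less_induct)
  case (less k)
  note p = less.prems(1)
  have V: "p j \<in> V" if "j \<le> k" for j using induced_pathD(1)[OF p that] by simp
  have sub: "p j \<in> R (p a) (p b)" if "a \<le> j" "j \<le> b" "b \<le> k" "b - a < k" for j a b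
    using less.IH[OF that(4) induced_path_sub[OF p, of a "b - a"], of "j - a"] that by simp
  have sub': "p j \<in> R (p b) (p a)" if "a \<le> j" "j \<le> b" "b \<le> k" "b - a < k" for j a b
    using sub[OF that] R_commute V that by auto
  have nb: "p b \<in> nb (p a) \<longleftrightarrow> b = a \<or> b = Suc a \<or> a = Suc b" if "a \<le> k" "b \<le> k" for a b
    using induced_pathD(2,3)[OF p that] by (auto simp: nb_def)
  have adj: "adj (p a) (p b) \<longleftrightarrow> b = Suc a \<or> a = Suc b" if "a \<le> k" "b \<le> k" for a b
    using induced_pathD(3)[OF p that] .
  have ne: "p a = p b \<longleftrightarrow> a = b" if "a \<le> k" "b \<le> k" for a b
    using induced_pathD(2)[OF p that] .
  let ?R = "R (p 0) (p k)"
  have RV: "?R = R (p k) (p 0)" using R_commute V by simp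
  have ends: "p 1 \<in> ?R \<and> p (k - 1) \<in> ?R" if k: "2 \<le> k"
  proof (cases "k = 2")
    case True
    have "R (p 0) (p 1) = {p 0, p 1}" "R (p 1) (p 2) = {p 1, p 2}" "R (p 0) (p 2) \<noteq> {p 0, p 2}" "p 0 \<noteq> p 2"
      using True V nb ne by (auto simp: R_eq_iff)
    moreover have "p 0 \<in> V" "p 1 \<in> V" "p 2 \<in> V" using V True by auto
    ultimately have "p 1 \<in> R (p 0) (p 2)" using J2 unfolding ax_J2_def by blast
    then show ?thesis using True by simp
  next
    case False
    then have "p 1 \<in> ?R"
      using k by (intro J4D[of "p 1" "p 0" "p (k - 1)" "p k"]) (auto simp: sub nb adj ne)
    moreover have "p (k - 1) \<in> R (p k) (p 0)"
      using k False by (intro J4D[of "p (k - 1)" "p k" "p 1" "p 0"]) (auto simp: sub' nb adj ne)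
    ultimately show ?thesis using RV by simp
  qed
  \<comment> \<open>(J4') is used with \<open>p (k - 2)\<close> as its \<open>y\<close>; the bound
    on \<open>j\<close> keeps it non-adjacent to \<open>p j\<close>.\<close>
  have left: "p j \<in> ?R" if "2 \<le> j" "j + 4 \<le> k" for j
    using that by (intro J4'D[of "p j" "p 0" "p (k - 2)" "p k"]) (auto simp: sub nb V)
  have right: "p j \<in> ?R" if "4 \<le> j" "j + 2 \<le> k" for j
    unfolding RV using that by (intro J4'D[of "p j" "p k" "p 2" "p 0"]) (auto simp: sub' nb V)
  \<comment> \<open>(TW1') with \<open>z = w = p j\<close>.\<close>
  have gap1: "p j \<in> ?R" if "p (j - 1) \<in> ?R" "p (Suc j) \<in> ?R" "2 \<le> j" "j + 2 \<le> k" for j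
    using that by (intro TW1'D[of "p (j - 1)" "p 0" "p k" "p (Suc j)" "p j" "p j"]) (auto simp: nb V adj ne)
  have gap2: "p 2 \<in> ?R \<and> p 3 \<in> ?R" if "p 1 \<in> ?R" "p 4 \<in> ?R" "k = 5"
  proof
    show "p 2 \<in> ?R"
      using that by (intro TW1'D[of "p 1" "p 0" "p k" "p 4" "p 2" "p 3"]) (auto simp: nb V adj ne)
    show "p 3 \<in> ?R"
      unfolding RV using that RV by (intro TW1'D[of "p 4" "p k" "p 0" "p 1" "p 3" "p 2"]) (auto simp: nb V adj ne)
  qed
  \<comment> \<open>Beyond the ends and the ranges of \<open>left\<close> and \<open>right\<close>,
    only \<open>(i, k)\<close> = (2, 4), (2, 5), (3, 5), (3, 6) remain.\<close>
  have "i = 0 \<or> i = k \<or> i = 1 \<and> 2 \<le> k \<or> i = k - 1 \<and> 2 \<le> k \<or> 2 \<le> i \<and> i + 4 \<le> k \<or>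
      4 \<le> i \<and> i + 2 \<le> k \<or> i = 2 \<and> k = 4 \<or> (i = 2 \<or> i = 3) \<and> k = 5 \<or> i = 3 \<and> k = 6"
    using less.prems(2) by presburger
  then consider "i = 0" | "i = k" | "i = 1" "2 \<le> k" | "i = k - 1" "2 \<le> k" | "2 \<le> i" "i + 4 \<le> k" | "4 \<le> i" "i + 2 \<le> k"
    | "i = 2" "k = 4" | "i = 2 \<or> i = 3" "k = 5" | "i = 3" "k = 6"
    by blast
  then show ?case
  proof cases
    case 7
    then show ?thesis using gap1[of 2] ends by simp
  next
    case 8
    then show ?thesis using gap2 ends by auto
  next
    case 9
    then show ?thesis using gap1[of 3] left[of 2] right[of 4] by simp
  qed (use V ends left right in auto)
qed

text \<open>(TW1') with \<open>x = y = w = s\<close>. Hence each component outside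
  \<open>nb u \<union> nb v\<close> lies wholly inside or wholly outside
  \<open>R u v\<close>.\<close>

lemma core_neighbour:
  assumes "s \<in> R u v" "s \<notin> nb u" "s \<notin> nb v" "adj s z" "u \<in> V" "v \<in> V"
  shows "z \<in> R u v"
  using assms by (intro TW1'D[of s u v s z s]) (auto simp: nb_def intro: adj_sym)

text \<open>An induced path from \<open>x\<close> to \<open>v\<close> outside \<open>nb u\<close>
  stays induced when \<open>u\<close> is prepended, so \<open>induced_path_R\<close>
  applies.\<close>

lemma toll_neighbour:
  assumes "toll u v x" "adj u x"
  shows "x \<in> R u v"
proof -
  have "x \<in> V" using assms(2) adj_iff by blast
  then obtain p k where p: "induced_path p k" "p 0 = x" "p k = v" "\<And>i. 0 < i \<Longrightarrow> i \<le> k \<Longrightarrow> p i \<notin> nb u"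
    using reach_induced_path[of "nb u" x v] assms(1) unfolding toll_def by auto
  then have "induced_path (case_nat u p) (Suc k)" using assms(2) by (intro induced_path_Cons) auto
  from induced_path_R[OF this, of 1] show ?thesis using p by simp
qed

lemma toll_in_R:
  assumes t: "toll u v x" and V: "u \<in> V" "v \<in> V"
  shows "x \<in> R u v"
proof (rule ccontr)
  assume xR: "x \<notin> R u v"
  have xV: "x \<in> V" using toll_verts[OF t] by simp
  have x: "x \<notin> nb u" "x \<notin> nb v" "v \<notin> nb u" "u \<notin> nb v"
    using toll_neighbour[OF t] toll_neighbour[of v u x] t xR R_commute[OF V] nb_commute
    by (auto simp: nb_def toll_def toll_commute)
  define K where "K = {y. reach (nb u \<union> nb v) x y}"
  \<comment> \<open>By \<open>core_neighbour\<close>, a vertex of \<open>R u v\<close> in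
    \<open>K\<close> would pull its predecessor into \<open>R u v\<close>, and finally
    \<open>x\<close>.\<close>
  have K: "y \<notin> nb u \<and> y \<notin> nb v \<and> y \<notin> R u v" if "y \<in> K" for y
    using that unfolding K_def reach_def mem_Collect_eq
  proof (induction rule: rtranclp_induct)
    case (step y z)
    then show ?case using core_neighbour[of z u v y] V adj_sym by blast
  qed (use x xR in auto)
  have xK: "x \<in> K" by (simp add: K_def)
  have Kstep: "z \<in> K" if "y \<in> K" "adj y z" "z \<notin> nb u \<union> nb v" for y z
    using that reach_trans reach_step unfolding K_def by blast
  have Kx: "reach (nb u \<union> nb v) y x" if "y \<in> K" for y
    using that x reach_sym unfolding K_def by blast
  \<comment> \<open>\<open>s\<close> is the first vertex in \<open>nb u\<close> on a walk from
    \<open>x\<close> to \<open>u\<close> outside \<open>nb v\<close>; \<open>t'\<close> is obtained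
    symmetrically.\<close>
  obtain k s where s: "k \<in> K" "adj k s" "s \<in> nb u" "s \<notin> nb v"
    using reach_first_hit[of "nb v" x u "nb u"] t x unfolding toll_def K_def
    by (metis (no_types, lifting) Un_commute mem_Collect_eq nb_self)
  obtain k' t' where t': "k' \<in> K" "adj k' t'" "t' \<in> nb v" "t' \<notin> nb u"
    using reach_first_hit[of "nb u" x v "nb v"] t x unfolding toll_def K_def
    by (metis (no_types, lifting) mem_Collect_eq nb_self)
  have us: "adj u s" and vt: "adj v t'" using s t' K[of k] K[of k'] adj_sym by (auto simp: nb_def)
  have through: "reach (nb u) y v" "reach (nb v) y u" if "z \<in> K" "adj y z" for y z
  proof -
    have "reach (nb u) y z" "reach (nb v) y z" using that K by (auto intro: reach_step)
    moreover have "reach (nb u) z x" "reach (nb v) z x"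
      using Kx[OF that(1)] by (auto intro: reach_mono)
    ultimately show "reach (nb u) y v" "reach (nb v) y u"
      using t reach_trans unfolding toll_def by blast+
  qed
  have "toll u v s" "toll v u t'"
    using through[of k s] through[of k' t'] s t' x us vt adj_sym[OF s(2)] adj_sym[OF t'(2)]
    by (auto simp: toll_def)
  then have sR: "s \<in> R u v" and tR: "t' \<in> R u v"
    using toll_neighbour us vt R_commute[OF V] by auto
  have st: "s \<noteq> t'" "s \<notin> K" "t' \<notin> K" using s t' K by blast+
  \<comment> \<open>A walk from \<open>k'\<close> to \<open>s\<close> inside \<open>K\<close> and
    \<open>s\<close> is cut at its last visit to \<open>D\<close>, so that only its first vertex
    \<open>m\<close> is a neighbour of \<open>t'\<close> in \<open>K\<close>.\<close>
  define D where "D = {d \<in> K. adj d t'}"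
  define S where "S = - (insert s K)"
  have "reach (nb u \<union> nb v) k' k"
    using Kx[OF t'(1)] s(1) reach_trans unfolding K_def by blast
  then have "reach (- K) k' k" using reach_closed(1)[of _ k' k K] t'(1) Kstep by blast
  then have "reach S k' k" by (rule reach_mono) (auto simp: S_def)
  moreover have "reach S k s" using s by (auto simp: S_def intro: reach_step)
  ultimately have "reach S k' s" by (rule reach_trans)
  then obtain m where m: "m \<in> D" "reach (S \<union> D) m s"
    using reach_last_hit[of S k' s D] t' unfolding D_def by blast
  have "m \<in> V" using m adj_iff by (auto simp: D_def)
  \<comment> \<open>The numbering starts at the \<open>t'\<close> end: the vertex k_i of the
    introduction is \<open>p (r - i)\<close>.\<close>
  then obtain p r where p: "induced_path p r" "p 0 = m" "p r = s"
    and pS: "\<And>i. 0 < i \<Longrightarrow> i \<le> r \<Longrightarrow> p i \<notin> S \<union> D"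
    using reach_induced_path[OF m(2)] by auto
  have r0: "0 < r" using p m st by (auto simp: D_def intro: gr0I)
  have pK: "p i \<in> K" if "i < r" for i
  proof (cases "i = 0")
    case False
    then have "p i \<in> insert s K" using pS[of i] that by (auto simp: S_def)
    moreover have "p i \<noteq> s" using induced_pathD(2)[OF p(1), of i r] that p by simp
    ultimately show ?thesis by blast
  qed (use m p in \<open>auto simp: D_def\<close>)
  have pt: "p i \<notin> nb t'" if "0 < i" "i < r" for i
    using pS[of i] pK[of i] that st adj_sym by (auto simp: D_def nb_def)
  have mt: "adj t' (p 0)" using m p adj_sym by (auto simp: D_def)
  have pnb: "p i \<notin> nb u" "p i \<notin> nb v" "p i \<notin> R u v" if "i < r" for i using K[OF pK[OF that]] by blast+
  have pv: "p i \<notin> nb v" if "i \<le> r" for i using pnb that s p by (cases "i = r") auto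
  have sp: "p i \<in> nb s \<longleftrightarrow> i = r - 1" if "i < r" for i
    using induced_pathD(2,3)[OF p(1), of r i] that p r0 by (auto simp: nb_def)
  \<comment> \<open>For smaller \<open>r\<close>, (TW1') along \<open>s\<close>,
    \<open>p (r - 1)\<close>, \<open>p 0\<close>, \<open>t'\<close> would put
    \<open>p (r - 1)\<close>, a vertex of \<open>K\<close>, into \<open>R u v\<close>.\<close>
  have r3: "3 \<le> r"
  proof (rule ccontr)
    assume "\<not> 3 \<le> r"
    then have "p 0 \<in> nb (p (r - 1))"
      using induced_pathD(3)[OF p(1), of "r - 1" 0] r0 by (cases "r = 1") (auto simp: nb_def)
    moreover have "adj s (p (r - 1))" using sp[of "r - 1"] r0 pK[of "r - 1"] st by (auto simp: nb_def)
    ultimately have "p (r - 1) \<in> R u v"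
      using r0 s t' us vt V mt pnb(1)[of 0] st
      by (intro TW1'D[OF sR tR, of "p (r - 1)" "p 0"]) (auto simp: nb_def[of "p 0"] intro: adj_sym)
    then show False using pnb(3)[of "r - 1"] r0 by simp
  qed
  show False
  proof (cases "adj s t'")
    case False
    have "p i \<notin> nb t'" if "0 < i" "i \<le> r" for i
      using pt[of i] that p False st adj_sym by (cases "i = r") (auto simp: nb_def)
    then have "induced_path (case_nat t' p) (Suc r)" by (intro induced_path_Cons[OF p(1) mt])
    then have "induced_path (case_nat v (case_nat t' p)) (Suc (Suc r))"
      by (rule induced_path_Cons) (use vt pv in \<open>auto split: nat.splits\<close>)
    note q = induced_path_rev[OF this]
    have "induced_path (case_nat u (\<lambda>i. case_nat v (case_nat t' p) (Suc (Suc r) - i))) (Suc (Suc (Suc r)))"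
      using us p pnb x t' by (intro induced_path_Cons[OF q]) (auto split: nat.splits)
    from induced_path_R[OF this, of 2] have "p (r - 1) \<in> R u v"
      using r3 by (auto simp: numeral_2_eq_2 Suc_diff_le split: nat.splits)
    then show False using pnb(3)[of "r - 1"] r0 by simp
  next
    case True
    \<comment> \<open>As \<open>r\<close> is at least 3, \<open>s\<close> is adjacent to neither
      \<open>p 0\<close> nor \<open>p 1\<close>, so \<open>u, s, t', p 0, p 1\<close> is induced. It
      gives \<open>t' \<in> R u ?c\<close>, and \<open>core_neighbour\<close> for the pair
      \<open>u\<close>, \<open>?c\<close> adds \<open>v\<close>.\<close>
    let ?c = "p 1"
    have c: "?c \<in> V" "?c \<notin> nb t'" "?c \<notin> nb s"
      using induced_pathD(1)[OF p(1), of 1] pt[of 1] sp[of 1] r3 by auto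
    have "induced_path p 1" using induced_path_sub[OF p(1), of 0 1] r3 by simp
    then have "induced_path (case_nat t' p) (Suc 1)"
      by (rule induced_path_Cons) (use mt c in \<open>auto simp: le_Suc_eq\<close>)
    then have "induced_path (case_nat s (case_nat t' p)) (Suc (Suc 1))"
      by (rule induced_path_Cons) (use True sp[of 0] c r3 in \<open>auto simp: le_Suc_eq\<close>)
    then have "induced_path (case_nat u (case_nat s (case_nat t' p))) (Suc (Suc (Suc 1)))"
      by (rule induced_path_Cons) (use us t' pnb(1)[of 0] pnb(1)[of 1] r3 in \<open>auto simp: le_Suc_eq\<close>)
    from induced_path_R[OF this, of 2] have "t' \<in> R u ?c" by (simp add: eval_nat_numeral)
    then have vR: "v \<in> R u ?c"
      using core_neighbour[of t' u ?c v] t' c V vt adj_sym nb_commute by blast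
    \<comment> \<open>From the other side, \<open>v, t', s, p (r - 1), ..., p 1\<close> is induced;
      \<open>p 0\<close> is left out as a neighbour of \<open>t'\<close>. This puts
      \<open>s\<close>, and then \<open>u\<close>, into \<open>R v ?c\<close>.\<close>
    have q: "induced_path (\<lambda>i. p (r - i)) (r - 1)"
      using induced_path_sub[OF induced_path_rev[OF p(1)], of 0 "r - 1"] by simp
    have "induced_path (case_nat t' (\<lambda>i. p (r - i))) (Suc (r - 1))"
      using pt True p adj_sym by (intro induced_path_Cons[OF q]) auto
    then have "induced_path (case_nat v (case_nat t' (\<lambda>i. p (r - i)))) (Suc (Suc (r - 1)))"
      by (rule induced_path_Cons) (use vt pv in \<open>auto split: nat.splits\<close>)
    from induced_path_R[OF this, of 2] have "s \<in> R v ?c"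
      using r3 p by (auto simp: numeral_2_eq_2 split: nat.splits)
    then have "u \<in> R v ?c"
      using core_neighbour[of s v ?c u] s c V us adj_sym nb_commute by blast
    \<comment> \<open>(b1') based at \<open>?c\<close>: for non-adjacent \<open>u\<close> and
      \<open>v\<close>, having \<open>v\<close> in \<open>R ?c u\<close> forbids \<open>u\<close> in
      \<open>R ?c v\<close>.\<close>
    moreover have "R u v \<noteq> {u, v}" "v \<noteq> u" using x V R_eq_iff by (auto simp: nb_def)
    ultimately show False
      using b1' vR V c(1) R_commute unfolding ax_b1'_def by metis
  qed
qed

lemma R_eq_interval: "u \<in> V \<Longrightarrow> v \<in> V \<Longrightarrow> R u v = interval u v"
  using R_sub_interval[of u v] toll_in_R[of u v] by (auto simp: interval_def)

text \<open>Each vertex of an asteroidal triple is a toll vertex between the other two, and two such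
  memberships clash under (b1').\<close>

lemma at_free_underlying: "at_free_graph (underlying_graph V R)"
proof unfold_locales
  fix a b c assume V: "a \<in> pverts (underlying_graph V R)" "b \<in> pverts (underlying_graph V R)"
      "c \<in> pverts (underlying_graph V R)"
    and c: "conn c a b" "conn a b c" "conn b a c"
  then have "toll a c b" "toll a b c" using conn_sym conn_nb by (blast intro: conn_toll)+
  then have "b \<in> R a c" "c \<in> R a b" using toll_in_R V by auto
  moreover have "b \<notin> nb c" using c conn_nb by blast
  ultimately show False using b1' V R_eq_iff unfolding ax_b1'_def
    by (metis nb_self pverts_underlying)
qed

end

theorem theorem10:
  fixes V :: "'a set" and R :: "'a \<Rightarrow> 'a \<Rightarrow> 'a set"
  assumes "finite V" and "transit_function V R"
  shows "(ax_b1' V R \<and> ax_b2' V R \<and> ax_J2 V R \<and> ax_J4 V R \<and> ax_J4' V R \<and> ax_TW1' V R \<and> ax_TWA V R)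
    \<longleftrightarrow> (AT_free (with_proj (underlying_graph V R)) \<and>
         (\<forall>u\<in>V. \<forall>v\<in>V. R u v = toll_transit (with_proj (underlying_graph V R)) u v))"
proof -
  interpret transit V R using assms by (rule transit.intro)
  let ?T = "toll_transit (with_proj (underlying_graph V R))"
  have AT: "AT_free (with_proj (underlying_graph V R)) \<longleftrightarrow> at_free_graph (underlying_graph V R)"
    using pair_graph_axioms
    by (auto simp: AT_free_iff at_free_graph_def at_free_graph_axioms_def)
  have RT: "R u v = ?T u v \<longleftrightarrow> R u v = interval u v" if V: "u \<in> V" "v \<in> V" for u v
  proof (cases "v \<in> nb u")
    case True
    then have "?T u v = {u, v}"
    proof (cases "u = v")
      case False
      then show ?thesis using True by (intro toll_transit_adjacent) (simp add: nb_def)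
    qed (simp add: toll_transit_def)
    then show ?thesis using True by (auto simp: interval_def toll_def)
  next
    case False
    \<comment> \<open>If there is no toll vertex, \<open>?T u v\<close> is empty and
      \<open>interval u v\<close> is \<open>{u, v}\<close>; \<open>R u v\<close> is neither, so both
      equations fail together.\<close>
    have "R u v \<noteq> {}" "R u v \<noteq> {u, v}"
      using R_ends(1)[OF V] R_eq_iff[OF V] False by blast+
    then show ?thesis by (auto simp: toll_transit_nonadjacent[OF False] interval_def)
  qed
  show ?thesis
  proof
    assume ax: "ax_b1' V R \<and> ax_b2' V R \<and> ax_J2 V R \<and> ax_J4 V R \<and> ax_J4' V R \<and> ax_TW1' V R \<and> ax_TWA V R"
    then interpret axiomatic_transit V R by unfold_locales auto
    show "AT_free (with_proj (underlying_graph V R)) \<and> (\<forall>u\<in>V. \<forall>v\<in>V. R u v = ?T u v)"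
      using AT at_free_underlying RT R_eq_interval by blast
  next
    assume "AT_free (with_proj (underlying_graph V R)) \<and> (\<forall>u\<in>V. \<forall>v\<in>V. R u v = ?T u v)"
    then have "at_free_graph (underlying_graph V R)" "\<And>u v. u \<in> V \<Longrightarrow> v \<in> V \<Longrightarrow> R u v = interval u v"
      using AT RT by blast+
    then show "ax_b1' V R \<and> ax_b2' V R \<and> ax_J2 V R \<and> ax_J4 V R \<and> ax_J4' V R \<and> ax_TW1' V R \<and> ax_TWA V R"
      using interval_axioms by blast
  qed
qed

end
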